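(* There exists an integer $N$ such that for every integer $n \geq N$ and every non-trivial graph property $f:\{0,1\}^{\binom{[n]}{2}} \to \{0,1\}$ on $n$ vertices, the sensitivity satisfies $s(f) \geq \lfloor \tfrac{1}{2} n \rfloor$.
   Context: Identify a string $x \in \{0,1\}^{\binom{[n]}{2}}$ (one bit $x_{\{i,j\}}$ for each unordered pair $\{i,j\}$ of distinct elements of $[n]=\{1,\dots,n\}$) with the graph on vertex set $[n]$ whose edges are the pairs $\{i,j\}$ with $x_{\{i,j\}}=1$. A function $f:\{0,1\}^{\binom{[n]}{2}} \to \{0,1\}$ is a graph property if $f(G)=f(H)$ whenever the graphs $G$ and $H$ on vertex set $[n]$ are isomorphic (equivalently, $f$ is invariant under the action of $S_n$ permuting the vertices). It is non-trivial if it is not constant. For a boolean function $f:\{0,1\}^m\to\{0,1\}$ and a point $x$, the sensitivity of $f$ at $x$ is $s(f,x)=|\{i \in [m] : f(x\oplus e_i)\neq f(x)\}|$, the number of coordinates whose flip changes the value of $f$ (for graph properties: the number of pairs $\{i,j\}$ whose addition or removal as an edge changes $f$); the sensitivity of $f$ is $s(f)=\max_x s(f,x)$. *)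

theory Defs
  imports Main "HOL-Combinatorics.Permutations"
begin

text \<open>Vertex set [n] is rendered as {0..<n}. The coordinates of the input are the
unordered pairs of distinct vertices; an input string x is identified with its
set of 1-coordinates, i.e. a set of edges E \<subseteq> vpairs n (a graph on [n]).\<close>

definition vpairs :: "nat \<Rightarrow> nat set set" where
  "vpairs n = {e. \<exists>i j. i < n \<and> j < n \<and> i \<noteq> j \<and> e = {i, j}}"

type_synonym graph_fun = "nat set set \<Rightarrow> bool"

definition is_graph_property :: "nat \<Rightarrow> graph_fun \<Rightarrow> bool" where
  "is_graph_property n f \<longleftrightarrow>
     (\<forall>\<sigma> E. \<sigma> permutes {0..<n} \<and> E \<subseteq> vpairs n \<longrightarrow> f ((\<lambda>e. \<sigma> ` e) ` E) = f E)"

definition nontrivial :: "nat \<Rightarrow> graph_fun \<Rightarrow> bool" where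
  "nontrivial n f \<longleftrightarrow> (\<exists>G H. G \<subseteq> vpairs n \<and> H \<subseteq> vpairs n \<and> f G \<noteq> f H)"

definition sens_at :: "nat \<Rightarrow> graph_fun \<Rightarrow> nat set set \<Rightarrow> nat" where
  "sens_at n f E = card {e \<in> vpairs n. f (E \<union> {e} - (E \<inter> {e})) \<noteq> f E}"

definition sensitivity :: "nat \<Rightarrow> graph_fun \<Rightarrow> nat" where
  "sensitivity n f = Max (sens_at n f ` Pow (vpairs n))"

end

theory Submission
  imports Defs
begin

text \<open>
  Suppose that \<open>f\<close> is false on the empty graph and all sensitivities are below \<open>k = n div 2\<close>.
  An inclusion-minimal graph \<open>G\<close> with \<open>f G\<close> has all its \<open>m\<close> edges sensitive, so \<open>m < k\<close>. Let
  \<open>d\<close> be the least positive degree occurring in any minimal graph, attained at \<open>u\<close> in \<open>G\<close>.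

  If \<open>d \<ge> 2\<close>, fix a neighbour \<open>v\<close> of \<open>u\<close> and add to \<open>G\<close> a maximal set of pairs between isolated
  vertices and the other neighbours of \<open>u\<close> that keeps \<open>f\<close> true. The missing pairs and the edges
  of \<open>G\<close> are sensitive, so all but fewer than \<open>k - m\<close> isolated vertices become copies of \<open>u\<close>
  lacking \<open>v\<close>. Removing the edge \<open>uv\<close> as well makes \<open>f\<close> false, and joining \<open>v\<close> to any of the at
  least \<open>k\<close> copies makes it true again.

  If \<open>d = 1\<close> and some component of \<open>G\<close> is a single edge, then \<open>G\<close> has few isolated vertices and
  consists almost entirely of single edges. Joining about \<open>k / 3\<close> of them to one end of a deleted
  single edge does not change \<open>f\<close>, and in the resulting spider every foot forms a sensitive
  pair with each of at least three isolated vertices.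

  If \<open>d = 1\<close> and no component is a single edge, there are many vertices with a leaf. For each two
  of them, moving the leaf edge of one to the leaf of the other makes \<open>f\<close> true, or one of the two
  pairs joining a vertex to the leaf of the other is sensitive in \<open>G\<close>; counting these pairs exceeds
  the bound.
\<close>

section \<open>Degrees and the handshake identity\<close>

definition deg :: "nat set set \<Rightarrow> nat \<Rightarrow> nat" where
  "deg E x = card {e \<in> E. x \<in> e}"

lemma finite_vpairs: "finite (vpairs n)"
proof (rule finite_subset)
  show "vpairs n \<subseteq> Pow {..<n}" by (auto simp: vpairs_def)
qed simp

lemma pair_in_vpairs: "{x, y} \<in> vpairs n \<longleftrightarrow> x < n \<and> y < n \<and> x \<noteq> y"
  by (auto simp: vpairs_def doubleton_eq_iff)

lemma vpairsE:
  assumes "e \<in> vpairs n"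
  obtains x y where "e = {x, y}" "x < n" "y < n" "x \<noteq> y"
  using assms by (auto simp: vpairs_def)

lemma vpairs_memE:
  assumes "e \<in> vpairs n" "x \<in> e"
  obtains y where "e = {x, y}" "x < n" "y < n" "x \<noteq> y"
  using assms by (auto simp: vpairs_def)

lemma deg_pos_iff: "finite E \<Longrightarrow> deg E x > 0 \<longleftrightarrow> (\<exists>e\<in>E. x \<in> e)"
  by (auto simp: deg_def card_gt_0_iff)

lemma deg_0_iff: "finite E \<Longrightarrow> deg E x = 0 \<longleftrightarrow> (\<forall>e\<in>E. x \<notin> e)"
  using deg_pos_iff[of E x] by auto

lemma deg_1_unique:
  assumes "deg E x = 1" "e \<in> E" "x \<in> e" "e' \<in> E" "x \<in> e'"
  shows "e = e'"
proof -
  obtain a where a: "{e \<in> E. x \<in> e} = {a}"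
    using assms(1) unfolding deg_def by (rule card_1_singletonE)
  have "e \<in> {e \<in> E. x \<in> e}" "e' \<in> {e \<in> E. x \<in> e}" using assms(2-5) by simp_all
  then show ?thesis unfolding a by simp
qed

text \<open>Counts the incidences between vertices of \<open>A\<close> and edges of \<open>E\<close>
  in two ways.\<close>

lemma sum_deg:
  assumes "finite E" "finite A"
  shows "(\<Sum>x\<in>A. deg E x) = (\<Sum>e\<in>E. card (e \<inter> A))"
proof -
  have d: "deg E x = (\<Sum>e\<in>E. if x \<in> e then 1 else 0)" for x
    using assms(1) by (simp add: deg_def sum.If_cases Int_def)
  have c: "card (e \<inter> A) = (\<Sum>x\<in>A. if x \<in> e then 1 else 0)" for e
    using assms(2) by (simp add: sum.If_cases Int_def conj_commute)
  show ?thesis unfolding d c by (rule sum.swap)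
qed

lemma handshake:
  assumes "E \<subseteq> vpairs n"
  shows "(\<Sum>x<n. deg E x) = 2 * card E"
proof -
  have "card (e \<inter> {..<n}) = 2" if e: "e \<in> E" for e
  proof -
    obtain x y where "e = {x, y}" "x < n" "y < n" "x \<noteq> y"
      using e assms by (meson subsetD vpairsE)
    moreover from this have "e \<inter> {..<n} = {x, y}" by auto
    ultimately show ?thesis by simp
  qed
  then show ?thesis
    using sum_deg[of E "{..<n}"] assms finite_subset[OF assms finite_vpairs] by simp
qed

section \<open>Counting isolated vertices, leaves and the neighbours of leaves\<close>

definition isolated :: "nat \<Rightarrow> nat set set \<Rightarrow> nat set" where
  "isolated n E = {x. x < n \<and> deg E x = 0}"

definition leaves :: "nat \<Rightarrow> nat set set \<Rightarrow> nat set" where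
  "leaves n E = {x. x < n \<and> deg E x = 1}"

definition single_edges :: "nat set set \<Rightarrow> nat set set" where
  "single_edges E = {e \<in> E. \<forall>x\<in>e. deg E x = 1}"

definition supports :: "nat \<Rightarrow> nat set set \<Rightarrow> nat set" where
  "supports n E = {v. v < n \<and> (\<exists>u. {u, v} \<in> E \<and> deg E u = 1)}"

lemma finite_isolated [simp]: "finite (isolated n E)"
  by (simp add: isolated_def)

lemma finite_leaves [simp]: "finite (leaves n E)"
  by (simp add: leaves_def)

lemma finite_supports [simp]: "finite (supports n E)"
  by (simp add: supports_def)

lemma single_edges_unique:
  assumes "e \<in> single_edges E" "e' \<in> E" "x \<in> e" "x \<in> e'"
  shows "e' = e"
  using assms deg_1_unique[of E x e' e] by (simp add: single_edges_def)

lemma single_edgesI: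
  assumes "e \<in> E" "\<And>e'. e' \<in> E \<Longrightarrow> e' \<inter> e \<noteq> {} \<Longrightarrow> e' = e"
  shows "e \<in> single_edges E"
proof -
  have "deg E x = 1" if "x \<in> e" for x
  proof -
    have "{e' \<in> E. x \<in> e'} = {e}" using assms that by blast
    then show ?thesis by (simp add: deg_def)
  qed
  then show ?thesis using assms(1) by (simp add: single_edges_def)
qed

lemma single_edges_subset: "single_edges E \<subseteq> E"
  by (auto simp: single_edges_def)

lemma card_leaves:
  assumes "finite E"
  shows "card (leaves n E) = (\<Sum>e\<in>E. card (e \<inter> leaves n E))"
proof -
  have "card (leaves n E) = (\<Sum>x\<in>leaves n E. deg E x)"
    by (simp add: leaves_def)
  then show ?thesis using sum_deg[OF assms, of "leaves n E"] by simp
qed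

text \<open>Give a leaf one extra unit and an isolated vertex two, so that every vertex weighs at
  least 2; the degrees themselves sum to \<open>2 * card E\<close>. Only a single edge has two leaf
  ends, which bounds the leaves by the edges plus the single edges.\<close>

lemma single_edges_bound:
  assumes "E \<subseteq> vpairs n"
  shows "2 * n \<le> 2 * card (isolated n E) + 3 * card E + card (single_edges E)"
proof -
  have fin: "finite E" using assms finite_vpairs finite_subset by blast
  have le: "card (e \<inter> leaves n E) \<le> 1 + (if e \<in> single_edges E then 1 else 0)" if eE: "e \<in> E" for e
  proof -
    obtain x y where e: "e = {x, y}" "x < n" "y < n" "x \<noteq> y"
      using eE assms by (meson subsetD vpairsE)
    show ?thesis
    proof (cases "e \<in> single_edges E")
      case True
      have "card (e \<inter> leaves n E) \<le> card e" using e by (intro card_mono) auto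
      then show ?thesis using True e by simp
    next
      case False
      then obtain z where z: "z \<in> e" "deg E z \<noteq> 1" using eE by (auto simp: single_edges_def)
      have "e \<inter> leaves n E \<subseteq> e - {z}" using z by (auto simp: leaves_def)
      then have "card (e \<inter> leaves n E) \<le> card (e - {z})" using e by (intro card_mono) auto
      then show ?thesis using z e False by (auto simp: card_insert_if)
    qed
  qed
  have "card (leaves n E) \<le> (\<Sum>e\<in>E. 1 + (if e \<in> single_edges E then 1 else 0))"
    unfolding card_leaves[OF fin] by (rule sum_mono) (rule le)
  also have "\<dots> = card E + card (single_edges E)"
  proof -
    have "E \<inter> {e. e \<in> single_edges E} = single_edges E" by (auto simp: single_edges_def)
    then show ?thesis using fin unfolding sum.distrib by (simp add: sum.If_cases)
  qed
  finally have L: "card (leaves n E) \<le> card E + card (single_edges E)" .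
  have "(\<Sum>x<n. 2) \<le> (\<Sum>x<n. deg E x + (if x \<in> leaves n E then 1 else 0)
      + (if x \<in> isolated n E then 2 else 0))"
    by (rule sum_mono) (auto simp: leaves_def isolated_def)
  also have "\<dots> = 2 * card E + card (leaves n E) + 2 * card (isolated n E)"
  proof -
    have "{..<n} \<inter> {x. x \<in> leaves n E} = leaves n E" "{..<n} \<inter> {x. x \<in> isolated n E} = isolated n E"
      by (auto simp: leaves_def isolated_def)
    then show ?thesis using handshake[OF assms] by (simp add: sum.distrib sum.If_cases)
  qed
  finally show ?thesis using L by simp
qed

text \<open>Similar weights, except that a support vertex is charged 2 in place of its degree.
  Without single edges no support vertex is a leaf, so each leaf sends its edge to a support vertex,
  and the degrees saved there pay for the leaves.\<close>

lemma supports_bound: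
  assumes "E \<subseteq> vpairs n" "single_edges E = {}"
  shows "n \<le> card E + card (isolated n E) + card (supports n E)"
proof -
  have fin: "finite E" using assms finite_vpairs finite_subset by blast
  let ?I = "isolated n E" and ?L = "leaves n E" and ?W = "supports n E"
  have disj: "?L \<inter> ?W = {}" "?I \<inter> ?W = {}"
  proof -
    have "deg E v \<noteq> 1" if "{u, v} \<in> E" "deg E u = 1" for u v
      using that assms(2) by (auto simp: single_edges_def)
    then show "?L \<inter> ?W = {}" by (auto simp: leaves_def supports_def)
    show "?I \<inter> ?W = {}" using fin by (auto simp: isolated_def supports_def deg_0_iff)
  qed
  have le: "card (e \<inter> ?L) \<le> card (e \<inter> ?W)" if eE: "e \<in> E" for e
  proof (cases "e \<inter> ?L = {}")
    case False
    then obtain x where x: "x \<in> e" "deg E x = 1" by (auto simp: leaves_def)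
    then obtain y where y: "e = {x, y}" "x < n" "y < n" "x \<noteq> y"
      using eE assms(1) by (meson subsetD vpairs_memE)
    have yW: "y \<in> ?W" using x y eE by (auto simp: supports_def)
    have "e \<inter> ?L \<subseteq> {x}" using y yW disj by auto
    then have "card (e \<inter> ?L) \<le> 1" using card_mono[of "{x}" "e \<inter> ?L"] by simp
    moreover have "card {y} \<le> card (e \<inter> ?W)" using yW y by (intro card_mono) auto
    ultimately show ?thesis by simp
  qed simp
  have LW: "card ?L \<le> (\<Sum>v\<in>?W. deg E v)"
    unfolding card_leaves[OF fin] sum_deg[OF fin finite_supports] by (rule sum_mono) (rule le)
  have "(\<Sum>x<n. 2) \<le> (\<Sum>x<n. (if x \<in> ?W then 0 else deg E x) + (if x \<in> ?L then 1 else 0)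
      + (if x \<in> ?I then 2 else 0) + (if x \<in> ?W then 2 else 0))"
    by (rule sum_mono) (auto simp: leaves_def isolated_def)
  also have "\<dots> = (\<Sum>x<n. if x \<in> ?W then 0 else deg E x) + card ?L + 2 * card ?I + 2 * card ?W"
  proof -
    have "{..<n} \<inter> {x. x \<in> ?L} = ?L" "{..<n} \<inter> {x. x \<in> ?I} = ?I" "{..<n} \<inter> {x. x \<in> ?W} = ?W"
      by (auto simp: leaves_def isolated_def supports_def)
    then show ?thesis by (simp add: sum.distrib sum.If_cases[where h = "\<lambda>_. 1"]
          sum.If_cases[where h = "\<lambda>_. 2"])
  qed
  also have "\<dots> \<le> 2 * card E + 2 * card ?I + 2 * card ?W"
  proof -
    have "(\<Sum>x<n. deg E x) = (\<Sum>x<n. (if x \<in> ?W then 0 else deg E x) + (if x \<in> ?W then deg E x else 0))"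
      by (rule sum.cong) auto
    also have "\<dots> = (\<Sum>x<n. if x \<in> ?W then 0 else deg E x) + (\<Sum>v\<in>?W. deg E v)"
    proof -
      have "{..<n} \<inter> {x. x \<in> ?W} = ?W" by (auto simp: supports_def)
      then show ?thesis by (simp add: sum.distrib sum.If_cases[where g = "\<lambda>_. 0"])
    qed
    finally show ?thesis using LW handshake[OF assms(1)] by simp
  qed
  finally show ?thesis by simp
qed

section \<open>Graph properties of low sensitivity\<close>

text \<open>Collects the assumptions of the proof by contradiction; \<open>k\<close> becomes
  \<open>n div 2\<close> at the end.\<close>

locale low_sensitivity =
  fixes n k :: nat and f :: graph_fun
  assumes graph_property: "is_graph_property n f"
    and low: "\<And>E. E \<subseteq> vpairs n \<Longrightarrow> sens_at n f E < k"
    and two_k: "2 * k \<le> n"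
begin

text \<open>The counting contradictions below all rest on this. The flip is split into deletion and
  insertion, so that one of the two cases can often be dismissed as impossible.\<close>

lemma sensitive_card:
  assumes "E \<subseteq> vpairs n" "S \<subseteq> vpairs n"
    and "\<And>e. e \<in> S \<Longrightarrow> e \<in> E \<Longrightarrow> f (E - {e}) \<noteq> f E"
    and "\<And>e. e \<in> S \<Longrightarrow> e \<notin> E \<Longrightarrow> f (insert e E) \<noteq> f E"
  shows "card S < k"
proof -
  have "S \<subseteq> {e \<in> vpairs n. f (E \<union> {e} - (E \<inter> {e})) \<noteq> f E}"
  proof
    fix e assume e: "e \<in> S"
    have "E \<union> {e} - (E \<inter> {e}) = (if e \<in> E then E - {e} else insert e E)" by auto
    then show "e \<in> {e \<in> vpairs n. f (E \<union> {e} - (E \<inter> {e})) \<noteq> f E}"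
      using assms(2-4) e by auto
  qed
  then have "card S \<le> sens_at n f E"
    unfolding sens_at_def by (intro card_mono) (simp_all add: finite_vpairs)
  then show ?thesis using low[OF assms(1)] by simp
qed

text \<open>The transposition fixes every edge of \<open>R\<close>, so only the edges in
  \<open>F\<close> move. Isomorphisms below are composed of such steps, each listing just the edges
  that change.\<close>

lemma swap_invariant:
  assumes "a < n" "b < n" "R \<union> F \<subseteq> vpairs n" "\<And>e. e \<in> R \<Longrightarrow> a \<notin> e \<and> b \<notin> e"
    and "F' = (\<lambda>e. transpose a b ` e) ` F"
  shows "f (R \<union> F') = f (R \<union> F)"
proof -
  have "transpose a b permutes {0..<n}"
    using assms(1,2) by (simp add: permutes_swap_id)
  then have "f ((\<lambda>e. transpose a b ` e) ` (R \<union> F)) = f (R \<union> F)"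
    using graph_property assms(3) unfolding is_graph_property_def by blast
  moreover have "transpose a b ` e = e" if e: "e \<in> R" for e
  proof -
    have "transpose a b ` e = (\<lambda>x. x) ` e"
      using assms(4)[OF e] by (intro image_cong refl) (auto simp: transpose_def)
    then show ?thesis by simp
  qed
  then have "(\<lambda>e. transpose a b ` e) ` R = (\<lambda>e. e) ` R" by (intro image_cong refl) auto
  ultimately show ?thesis by (simp add: assms(5) image_Un)
qed

definition minimal :: "nat set set \<Rightarrow> bool" where
  "minimal G \<longleftrightarrow> G \<subseteq> vpairs n \<and> f G \<and> (\<forall>H. H \<subset> G \<longrightarrow> \<not> f H)"

lemma minimal_subgraph:
  assumes "E \<subseteq> vpairs n" "f E"
  obtains C where "C \<subseteq> E" "minimal C"
proof -
  have "finite E" using assms(1) finite_vpairs finite_subset by blast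
  then have "finite {H \<in> Pow E. f H}" by simp
  moreover have "E \<in> {H \<in> Pow E. f H}" using assms(2) by simp
  ultimately obtain C where C: "C \<in> {H \<in> Pow E. f H}" "C \<subseteq> E"
    and min: "\<forall>H\<in>{H \<in> Pow E. f H}. H \<subseteq> C \<longrightarrow> C = H"
    using finite_has_minimal2[of "{H \<in> Pow E. f H}" E] by auto
  have "minimal C" unfolding minimal_def using C min assms(1) by blast
  then show ?thesis using C(2) that by blast
qed

section \<open>Least positive degree at least two\<close>

text \<open>The bound \<open>d\<close> ranges over all minimal graphs, not only \<open>G\<close>.
  Hence edges that give each isolated vertex degree at most \<open>d - 1\<close> cannot belong to a
  new minimal graph, and the edges of \<open>G\<close> stay sensitive after such additions.\<close>

lemma no_minimal_min_degree_ge_2: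
  assumes G: "minimal G" and u: "u < n" "deg G u = d" and d2: "d \<ge> 2"
    and least: "\<And>C x. minimal C \<Longrightarrow> x < n \<Longrightarrow> deg C x > 0 \<Longrightarrow> d \<le> deg C x"
  shows False
proof -
  have Gv: "G \<subseteq> vpairs n" and fG: "f G" and sub: "\<And>H. H \<subset> G \<Longrightarrow> \<not> f H"
    using G by (auto simp: minimal_def)
  have fin: "finite G" using Gv finite_vpairs finite_subset by blast
  define N where "N = {v. {u, v} \<in> G}"
  have N: "v < n" "v \<noteq> u" if "v \<in> N" for v
    using that Gv pair_in_vpairs unfolding N_def by blast+
  have finN: "finite N" using N by (meson finite_nat_set_iff_bounded)
  have inc: "{e \<in> G. u \<in> e} = (\<lambda>v. {u, v}) ` N"
  proof
    show "{e \<in> G. u \<in> e} \<subseteq> (\<lambda>v. {u, v}) ` N"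
    proof
      fix e assume e: "e \<in> {e \<in> G. u \<in> e}"
      then obtain v where "e = {u, v}" using Gv by (metis (lifting) mem_Collect_eq subsetD vpairs_memE)
      then show "e \<in> (\<lambda>v. {u, v}) ` N" using e unfolding N_def by auto
    qed
  qed (auto simp: N_def)
  have "inj_on (\<lambda>v. {u, v}) N" by (auto simp: inj_on_def doubleton_eq_iff)
  then have cardN: "card N = d" using u(2) unfolding deg_def inc by (simp add: card_image)
  then obtain v1 where v1: "v1 \<in> N" using d2 by fastforce
  \<comment> \<open>One neighbour is left out so that an isolated vertex joined to all of
    \<open>T\<close> has degree only \<open>d - 1\<close>.\<close>
  define T where "T = N - {v1}"
  have finT: "finite T" and cardT: "card T = d - 1" and TN: "T \<subseteq> N"
    using finN cardN v1 by (auto simp: T_def)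
  define I where "I = isolated n G"
  have I: "x < n" "\<And>e. e \<in> G \<Longrightarrow> x \<notin> e" if "x \<in> I" for x
    using that fin by (auto simp: I_def isolated_def deg_0_iff)
  have finI: "finite I" by (simp add: I_def)
  have uI: "u \<notin> I" using I(2)[of u] v1 unfolding N_def by blast
  have NI: "v \<notin> I" if "v \<in> N" for v using I(2)[of v] that unfolding N_def by blast
  define P where "P = {{x, v} | x v. x \<in> I \<and> v \<in> T}"
  have Pv: "P \<subseteq> vpairs n"
    using I(1) N NI TN unfolding P_def by (fastforce simp: pair_in_vpairs)
  have finP: "finite P" using Pv finite_vpairs finite_subset by blast
  have GP: "G \<inter> P = {}" using I(2) unfolding P_def by blast
  \<comment> \<open>Maximality of \<open>\<alpha>\<close> will make every pair in
    \<open>P - \<alpha>\<close> sensitive.\<close>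
  have "finite {\<alpha> \<in> Pow P. f (G \<union> \<alpha>)}" using finP by simp
  moreover have "{} \<in> {\<alpha> \<in> Pow P. f (G \<union> \<alpha>)}" using fG by simp
  ultimately obtain \<alpha> where \<alpha>': "\<alpha> \<in> {\<alpha> \<in> Pow P. f (G \<union> \<alpha>)}"
    and max: "\<forall>\<beta>\<in>{\<alpha> \<in> Pow P. f (G \<union> \<alpha>)}. \<alpha> \<subseteq> \<beta> \<longrightarrow> \<alpha> = \<beta>"
    using finite_has_maximal2[of "{\<alpha> \<in> Pow P. f (G \<union> \<alpha>)}" "{}"] by auto
  from \<alpha>' have \<alpha>P: "\<alpha> \<subseteq> P" and f\<alpha>: "f (G \<union> \<alpha>)" by auto
  have \<alpha>v: "\<alpha> \<subseteq> vpairs n" using \<alpha>P Pv by blast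
  \<comment> \<open>Each vertex of \<open>I\<close> has degree below \<open>d\<close> in \<open>S \<union> \<alpha>\<close>, so it lies in no minimal graph.\<close>
  have zero: "\<not> f (S \<union> \<alpha>)" if S: "S \<subset> G" for S
  proof
    assume "f (S \<union> \<alpha>)"
    then obtain C where C: "C \<subseteq> S \<union> \<alpha>" "minimal C"
      using minimal_subgraph[of "S \<union> \<alpha>"] S Gv \<alpha>v by blast
    have finC: "finite C" using C(2) finite_vpairs finite_subset unfolding minimal_def by blast
    have "C \<subseteq> S"
    proof
      fix e assume e: "e \<in> C"
      show "e \<in> S"
      proof (rule ccontr)
        assume "e \<notin> S"
        then have "e \<in> P" using e C(1) \<alpha>P by blast
        then obtain x v where x: "e = {x, v}" "x \<in> I" "v \<in> T" unfolding P_def by blast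
        have "deg C x > 0" using e x finC by (auto simp: deg_pos_iff)
        then have "d \<le> deg C x" using least[OF C(2)] I(1)[OF x(2)] by blast
        moreover have "{e \<in> C. x \<in> e} \<subseteq> (\<lambda>v. {x, v}) ` T"
        proof
          fix e' assume e': "e' \<in> {e \<in> C. x \<in> e}"
          then have "e' \<in> P" using I(2)[OF x(2)] C(1) S \<alpha>P by blast
          then obtain y w where y: "e' = {y, w}" "y \<in> I" "w \<in> T" unfolding P_def by blast
          moreover have "x \<noteq> w" using x(2) y(3) NI TN by blast
          ultimately show "e' \<in> (\<lambda>v. {x, v}) ` T" using e' by auto
        qed
        then have "deg C x \<le> card T"
          unfolding deg_def using finT surj_card_le by blast
        ultimately show False using cardT d2 by simp
      qed
    qed
    then show False using sub[of C] S C(2) unfolding minimal_def by blast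
  qed
  have "card (G \<union> (P - \<alpha>)) < k"
  proof (rule sensitive_card[of "G \<union> \<alpha>"])
    fix e assume e: "e \<in> G \<union> (P - \<alpha>)" "e \<in> G \<union> \<alpha>"
    then have "e \<in> G" "e \<notin> \<alpha>" using GP \<alpha>P by blast+
    then have "G \<union> \<alpha> - {e} = (G - {e}) \<union> \<alpha>" "G - {e} \<subset> G" by blast+
    then show "f (G \<union> \<alpha> - {e}) \<noteq> f (G \<union> \<alpha>)" using zero f\<alpha> by auto
  next
    fix e assume e: "e \<in> G \<union> (P - \<alpha>)" "e \<notin> G \<union> \<alpha>"
    then have "\<not> f (G \<union> insert e \<alpha>)" using max \<alpha>P by blast
    then show "f (insert e (G \<union> \<alpha>)) \<noteq> f (G \<union> \<alpha>)" using f\<alpha> by auto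
  qed (use Gv \<alpha>v Pv in auto)
  moreover have "card (G \<union> (P - \<alpha>)) = card G + card (P - \<alpha>)"
    using fin finP GP by (intro card_Un_disjoint) auto
  ultimately have missing: "card G + card (P - \<alpha>) < k" by simp
  \<comment> \<open>In \<open>G \<union> \<alpha>\<close> a vertex of \<open>X\<close> has
    neighbourhood exactly \<open>T\<close>, like \<open>u\<close> once \<open>{u, v1}\<close> is
    removed. Every other vertex of \<open>I\<close> misses some pair of \<open>P\<close>, which
    gives an injection into \<open>P - \<alpha>\<close>.\<close>
  define X where "X = {x \<in> I. \<forall>v\<in>T. {x, v} \<in> \<alpha>}"
  have "\<forall>x\<in>I - X. \<exists>v. v \<in> T \<and> {x, v} \<notin> \<alpha>" by (auto simp: X_def)
  then obtain g where g: "\<And>x. x \<in> I - X \<Longrightarrow> g x \<in> T \<and> {x, g x} \<notin> \<alpha>" by metis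
  have "card (I - X) \<le> card (P - \<alpha>)"
  proof (rule card_inj_on_le[of "\<lambda>x. {x, g x}"])
    show "inj_on (\<lambda>x. {x, g x}) (I - X)"
    proof (rule inj_onI)
      fix x y assume xy: "x \<in> I - X" "y \<in> I - X" "{x, g x} = {y, g y}"
      have "x \<noteq> g y" using g[OF xy(2)] xy(1) NI TN by blast
      then show "x = y" using xy(3) by (auto simp: doubleton_eq_iff)
    qed
    show "(\<lambda>x. {x, g x}) ` (I - X) \<subseteq> P - \<alpha>" using g unfolding P_def by blast
  qed (use finP in auto)
  moreover have "card I = card X + card (I - X)"
  proof -
    have "X \<subseteq> I" by (auto simp: X_def)
    then show ?thesis using finI by (metis card_Diff_subset card_mono finite_subset le_add_diff_inverse)
  qed
  ultimately have IX: "card I \<le> card X + card (P - \<alpha>)" by simp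
  have "n \<le> card I + card G"
  proof -
    have "(\<Sum>x<n. 2) \<le> (\<Sum>x<n. deg G x + (if x \<in> I then 2 else 0))"
    proof (rule sum_mono)
      fix x assume x: "x \<in> {..<n}"
      then show "2 \<le> deg G x + (if x \<in> I then 2 else 0)"
        using least[OF G, of x] d2 by (cases "deg G x = 0") (auto simp: I_def isolated_def)
    qed
    also have "\<dots> = 2 * card G + 2 * card I"
    proof -
      have "{..<n} \<inter> {x. x \<in> I} = I" by (auto simp: I_def isolated_def)
      then show ?thesis using handshake[OF Gv] by (simp add: sum.distrib sum.If_cases)
    qed
    finally show ?thesis by simp
  qed
  \<comment> \<open>\<open>X\<close> has at least \<open>n - card G - card (P - \<alpha>)\<close>
    elements, which exceeds \<open>n - k\<close>.\<close>
  then have "k \<le> card X" using IX missing two_k by linarith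
  moreover have "card X < k"
  proof -
    define Z where "Z = (G - {{u, v1}}) \<union> \<alpha>"
    have uv1: "{u, v1} \<in> G" using v1 by (simp add: N_def)
    have fZ: "\<not> f Z" unfolding Z_def by (rule zero) (use uv1 in blast)
    have "card ((\<lambda>x. {x, v1}) ` X) < k"
    proof (rule sensitive_card[of Z])
      show "Z \<subseteq> vpairs n" using Gv \<alpha>v by (auto simp: Z_def)
      show "(\<lambda>x. {x, v1}) ` X \<subseteq> vpairs n"
        using I(1) N[OF v1] NI[OF v1] by (auto simp: X_def pair_in_vpairs)
    next
      fix e assume e: "e \<in> (\<lambda>x. {x, v1}) ` X" "e \<in> Z"
      then obtain x where x: "x \<in> X" "e = {x, v1}" by blast
      then have "x \<in> I" by (simp add: X_def)
      then have "e \<in> P" using e(2) x(2) I(2) \<alpha>P unfolding Z_def by blast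
      then obtain y v where "e = {y, v}" "y \<in> I" "v \<in> T" unfolding P_def by blast
      then have "v1 \<in> T \<or> v1 \<in> I" using x(2) by (auto simp: doubleton_eq_iff)
      then show "f (Z - {e}) \<noteq> f Z" using NI[OF v1] by (auto simp: T_def)
    next
      fix e assume e: "e \<in> (\<lambda>x. {x, v1}) ` X" "e \<notin> Z"
      then obtain x where x: "x \<in> X" "e = {x, v1}" by blast
      then have xI: "x \<in> I" and xT: "\<And>v. v \<in> T \<Longrightarrow> {x, v} \<in> \<alpha>" by (auto simp: X_def)
      \<comment> \<open>Exchanging \<open>u\<close> and \<open>x\<close> maps
        \<open>G \<union> \<alpha>\<close> to \<open>insert e Z\<close>: \<open>F\<close> holds the
        edges at \<open>u\<close> or \<open>x\<close> before the exchange, \<open>F'\<close> those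
        after it, and \<open>R\<close> the rest.\<close>
      define R where "R = {e \<in> G \<union> \<alpha>. u \<notin> e \<and> x \<notin> e}"
      define F where "F = (\<lambda>v. {u, v}) ` N \<union> (\<lambda>v. {x, v}) ` T"
      define F' where "F' = (\<lambda>v. {x, v}) ` N \<union> (\<lambda>v. {u, v}) ` T"
      have xu: "x \<noteq> u" using uI xI by blast
      have u\<alpha>: "u \<notin> e" if "e \<in> \<alpha>" for e
        using that \<alpha>P uI N(2) TN unfolding P_def by blast
      have x\<alpha>: "e \<in> (\<lambda>v. {x, v}) ` T" if e: "e \<in> \<alpha>" "x \<in> e" for e
      proof -
        obtain y v where y: "e = {y, v}" "y \<in> I" "v \<in> T" using e(1) \<alpha>P unfolding P_def by blast
        moreover have "x \<noteq> v" using xI y(3) NI TN by blast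
        ultimately show ?thesis using e(2) by auto
      qed
      have RF: "R \<union> F = G \<union> \<alpha>"
      proof
        show "R \<union> F \<subseteq> G \<union> \<alpha>" using xT by (auto simp: R_def F_def N_def)
        show "G \<union> \<alpha> \<subseteq> R \<union> F"
        proof
          fix e assume e: "e \<in> G \<union> \<alpha>"
          consider "u \<in> e" | "x \<in> e" | "u \<notin> e" "x \<notin> e" by blast
          then show "e \<in> R \<union> F"
          proof cases
            case 1
            then have "e \<in> {e \<in> G. u \<in> e}" using e u\<alpha> by blast
            then show ?thesis unfolding inc F_def by blast
          next
            case 2
            then show ?thesis using e I(2)[OF xI] x\<alpha> unfolding F_def by blast
          qed (use e in \<open>auto simp: R_def\<close>)
        qed
      qed
      have RF': "R \<union> F' = insert e Z"
      proof
        have "{x, v} \<in> insert e Z" if "v \<in> N" for v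
          using that xT x(2) by (cases "v = v1") (auto simp: Z_def T_def)
        moreover have "{u, v} \<in> Z" if "v \<in> T" for v
          using that by (auto simp: Z_def T_def N_def doubleton_eq_iff)
        ultimately show "R \<union> F' \<subseteq> insert e Z" by (auto simp: R_def F'_def Z_def)
        show "insert e Z \<subseteq> R \<union> F'"
        proof
          fix e' assume e': "e' \<in> insert e Z"
          consider "e' = e" | "e' \<noteq> e" "u \<in> e'" | "e' \<noteq> e" "x \<in> e'" | "e' \<noteq> e" "u \<notin> e'" "x \<notin> e'" by blast
          then show "e' \<in> R \<union> F'"
          proof cases
            case 1
            then show ?thesis using x(2) v1 by (auto simp: F'_def)
          next
            case 2
            then have "e' \<in> {e \<in> G. u \<in> e}" "e' \<noteq> {u, v1}" using e' u\<alpha> by (auto simp: Z_def)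
            then show ?thesis unfolding inc F'_def T_def by auto
          next
            case 3
            then have "e' \<in> \<alpha>" using e' I(2)[OF xI] by (auto simp: Z_def)
            then show ?thesis using x\<alpha> 3(2) TN unfolding F'_def by blast
          next
            case 4
            then show ?thesis using e' by (auto simp: R_def Z_def)
          qed
        qed
      qed
      have img: "F' = (\<lambda>e. transpose u x ` e) ` F"
      proof -
        have t: "transpose u x v = v" if "v \<in> N" for v
          using N(2)[OF that] NI[OF that] xI by (auto simp: transpose_def)
        have "(\<lambda>e. transpose u x ` e) ` (\<lambda>v. {u, v}) ` N = (\<lambda>v. {x, v}) ` N"
          unfolding image_image by (rule image_cong) (auto simp: t)
        moreover have "(\<lambda>e. transpose u x ` e) ` (\<lambda>v. {x, v}) ` T = (\<lambda>v. {u, v}) ` T"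
          unfolding image_image by (rule image_cong) (use TN in \<open>auto simp: t subset_iff\<close>)
        ultimately show ?thesis by (simp add: F_def F'_def image_Un)
      qed
      have "f (R \<union> F') = f (R \<union> F)"
        by (rule swap_invariant[OF u(1) I(1)[OF xI] _ _ img])
          (use RF Gv \<alpha>v in \<open>auto simp: R_def\<close>)
      then show "f (insert e Z) \<noteq> f Z" using RF RF' f\<alpha> fZ by simp
    qed
    moreover have "inj_on (\<lambda>x. {x, v1}) X" by (auto simp: inj_on_def doubleton_eq_iff)
    ultimately show ?thesis by (simp add: card_image)
  qed
  ultimately show False by simp
qed

section \<open>Attaching vertices to single edges\<close>

text \<open>Some automorphism of \<open>E\<close> carries \<open>x\<close> to \<open>y\<close> and
  fixes \<open>c\<close>: the identity or a reversal of the edge if \<open>e = e'\<close>, and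
  otherwise an exchange of the two edges, made of one transposition of the near ends and one of the
  far ends.\<close>

lemma pendant_swap:
  assumes E: "E \<subseteq> vpairs n" and e: "e \<in> single_edges E" "x \<in> e"
    and e': "e' \<in> single_edges E" "y \<in> e'" and c: "c < n" "c \<notin> e" "c \<notin> e'"
  shows "f (insert {c, y} E) = f (insert {c, x} E)"
proof -
  have eE: "e \<in> E" "e' \<in> E" using e e' single_edges_subset by blast+
  have uniq: "d = e" if "d \<in> E" "z \<in> d" "z \<in> e" for d z
    using single_edges_unique[OF e(1) that(1,3,2)] .
  have uniq': "d = e'" if "d \<in> E" "z \<in> d" "z \<in> e'" for d z
    using single_edges_unique[OF e'(1) that(1,3,2)] .
  obtain x' where x': "e = {x, x'}" "x < n" "x' < n" "x \<noteq> x'"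
    using eE E e(2) by (meson subsetD vpairs_memE)
  obtain y' where y': "e' = {y, y'}" "y < n" "y' < n" "y \<noteq> y'"
    using eE E e'(2) by (meson subsetD vpairs_memE)
  have cne: "c \<noteq> x" "c \<noteq> x'" "c \<noteq> y" "c \<noteq> y'" using c x'(1) y'(1) by auto
  show ?thesis
  proof (cases "e = e'")
    case True
    show ?thesis
    proof (cases "x = y")
      case False
      then have yx: "y = x'" using True x' y' by auto
      have "f ((E - {e}) \<union> {{x, x'}, {c, x'}}) = f ((E - {e}) \<union> {{x, x'}, {c, x}})"
      proof (rule swap_invariant[of x x'])
        show "(E - {e}) \<union> {{x, x'}, {c, x}} \<subseteq> vpairs n"
          using E x' c cne by (auto simp: pair_in_vpairs)
        show "x \<notin> d \<and> x' \<notin> d" if "d \<in> E - {e}" for d using that uniq x'(1) by blast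
        show "{{x, x'}, {c, x'}} = (\<lambda>e. transpose x x' ` e) ` {{x, x'}, {c, x}}"
          using x'(4) cne by (simp add: transpose_apply_other insert_commute)
      qed (use x' in auto)
      moreover have "(E - {e}) \<union> {{x, x'}, {c, z}} = insert {c, z} E" for z
        using eE x'(1) by auto
      ultimately show ?thesis using yx by simp
    qed simp
  next
    case False
    then have "e \<inter> e' = {}" using uniq eE by blast
    then have ne: "x \<noteq> y" "x \<noteq> y'" "x' \<noteq> y" "x' \<noteq> y'" using x' y' by auto
    define R where "R = E - {e, e'}"
    have R: "x \<notin> d \<and> y \<notin> d" "x' \<notin> d \<and> y' \<notin> d" if "d \<in> R" for d
      using that uniq uniq' x'(1) y'(1) unfolding R_def by blast+
    let ?F = "{{x, x'}, {y, y'}, {c, x}}" and ?F1 = "{{y, x'}, {x, y'}, {c, y}}"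
      and ?F2 = "{{y, y'}, {x, x'}, {c, y}}"
    have "f (R \<union> ?F1) = f (R \<union> ?F)"
    proof (rule swap_invariant[of x y])
      show "R \<union> ?F \<subseteq> vpairs n" using E x' y' c cne by (auto simp: pair_in_vpairs R_def)
      show "?F1 = (\<lambda>e. transpose x y ` e) ` ?F" using x' y' cne ne by (simp add: transpose_apply_other insert_commute)
    qed (use x' y' R in auto)
    moreover have "f (R \<union> ?F2) = f (R \<union> ?F1)"
    proof (rule swap_invariant[of x' y'])
      show "R \<union> ?F1 \<subseteq> vpairs n" using E x' y' c cne ne by (auto simp: pair_in_vpairs R_def)
      show "?F2 = (\<lambda>e. transpose x' y' ` e) ` ?F1" using x' y' cne ne by (simp add: transpose_apply_other insert_commute)
    qed (use x' y' R in auto)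
    moreover have "R \<union> ?F = insert {c, x} E" "R \<union> ?F2 = insert {c, y} E"
      using eE x'(1) y'(1) by (auto simp: R_def)
    ultimately show ?thesis by simp
  qed
qed

text \<open>By \<open>pendant_swap\<close> the pairs joining \<open>c\<close> to the ends of edges
  in \<open>D\<close> all change the value or none does. There are \<open>2 * card D\<close> of
  them, too many to be sensitive.\<close>

lemma attach_single_edge:
  assumes E: "E \<subseteq> vpairs n" and D: "D \<subseteq> single_edges E" and e: "e \<in> D" "x \<in> e"
    and c: "c < n" "c \<notin> \<Union>D" and k: "k \<le> 2 * card D"
  shows "f (insert {c, x} E) = f E"
proof (rule ccontr)
  assume neq: "f (insert {c, x} E) \<noteq> f E"
  have DE: "D \<subseteq> E" using D single_edges_subset by blast
  have two: "finite d \<and> card d = 2" if d: "d \<in> D" for d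
  proof -
    obtain a b where "d = {a, b}" "a \<noteq> b" using d DE E by (meson subsetD vpairsE)
    then show ?thesis by simp
  qed
  have "card ((\<lambda>y. {c, y}) ` \<Union>D) < k"
  proof (rule sensitive_card[OF E])
    show "(\<lambda>y. {c, y}) ` \<Union>D \<subseteq> vpairs n"
    proof
      fix p assume "p \<in> (\<lambda>y. {c, y}) ` \<Union>D"
      then obtain y d where y: "p = {c, y}" "y \<in> d" "d \<in> D" by blast
      then have "y < n" using DE E by (meson subsetD vpairs_memE)
      then show "p \<in> vpairs n" using y c by (auto simp: pair_in_vpairs)
    qed
  next
    fix p assume p: "p \<in> (\<lambda>y. {c, y}) ` \<Union>D" "p \<in> E"
    then obtain y d where y: "p = {c, y}" "y \<in> d" "d \<in> D" by blast
    then have "p = d" using single_edges_unique[of d E p y] p(2) D by blast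
    then show "f (E - {p}) \<noteq> f E" using y c(2) by blast
  next
    fix p assume "p \<in> (\<lambda>y. {c, y}) ` \<Union>D"
    then obtain y d where y: "p = {c, y}" "y \<in> d" "d \<in> D" by blast
    have "f (insert {c, y} E) = f (insert {c, x} E)"
      by (rule pendant_swap[OF E _ e(2) _ y(2) c(1)]) (use D e y c(2) in auto)
    then show "f (insert p E) \<noteq> f E" using neq y(1) by simp
  qed
  moreover have "inj_on (\<lambda>y. {c, y}) (\<Union>D)" by (auto simp: inj_on_def doubleton_eq_iff)
  moreover have "card (\<Union>D) = 2 * card D"
  proof -
    have "pairwise disjnt D"
    proof (rule pairwiseI)
      fix d d' assume d: "d \<in> D" "d' \<in> D" "d \<noteq> d'"
      then have "d \<in> single_edges E" "d' \<in> E" using D DE by blast+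
      then show "disjnt d d'" using d(3) single_edges_unique[of d E d'] unfolding disjnt_def by blast
    qed
    then have "card (\<Union>D) = (\<Sum>d\<in>D. card d)" using two by (intro card_Union_disjoint) auto
    then show ?thesis using two by simp
  qed
  ultimately show False using k by (simp add: card_image)
qed

text \<open>Attach one edge at a time; the unattached edges of \<open>D\<close> remain single
  because the centres lie outside \<open>\<Union>D\<close>. The \<open>+ 2\<close> in the budget
  reflects that the last edge is still single at its own step. The centre may depend on the edge,
  since the spider argument uses two centres.\<close>

lemma attach_single_edges:
  assumes E: "E \<subseteq> vpairs n" and D: "D \<subseteq> single_edges E" and J: "finite J" "J \<subseteq> D"
    and h: "\<And>e. e \<in> J \<Longrightarrow> h e \<in> e" and c: "\<And>e. e \<in> J \<Longrightarrow> c e < n \<and> c e \<notin> \<Union>D"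
    and k: "k + 2 * card J \<le> 2 * card D + 2"
  shows "f (E \<union> (\<lambda>e. {c e, h e}) ` J) = f E"
  using J h c k
proof (induction J)
  case (insert e J)
  let ?E = "E \<union> (\<lambda>e. {c e, h e}) ` J"
  have DE: "D \<subseteq> E" using D single_edges_subset by blast
  have hn: "h e < n" if e: "e \<in> J" for e
  proof -
    have "e \<in> vpairs n" "h e \<in> e" using e insert.prems DE E by auto
    then show ?thesis by (meson vpairs_memE)
  qed
  have Ev: "?E \<subseteq> vpairs n"
  proof -
    have "{c e, h e} \<in> vpairs n" if e: "e \<in> J" for e
    proof -
      have "h e \<in> \<Union>D" using e insert.prems(1,2) by blast
      then have "c e \<noteq> h e" using insert.prems(3)[of e] e by auto
      then show ?thesis using insert.prems(3)[of e] e hn by (auto simp: pair_in_vpairs)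
    qed
    then show ?thesis using E by auto
  qed
  have D': "D - J \<subseteq> single_edges ?E"
  proof
    fix d assume d: "d \<in> D - J"
    then have dE: "d \<in> E" using DE by blast
    have uniq: "d' = d" if "d' \<in> E" "d' \<inter> d \<noteq> {}" for d'
      using single_edges_unique[of d E d'] that d D by blast
    have disj: "{c j, h j} \<inter> d = {}" if j: "j \<in> J" for j
    proof -
      have "c j \<notin> d" using insert.prems(3)[of j] j d by blast
      moreover have "h j \<notin> d"
      proof
        assume "h j \<in> d"
        then have "j \<inter> d \<noteq> {}" using insert.prems(2)[of j] j by blast
        moreover have "j \<in> E" using j insert.prems(1) DE by blast
        ultimately have "j = d" by (rule uniq[rotated])
        then show False using j d by blast
      qed
      ultimately show ?thesis by blast
    qed
    show "d \<in> single_edges ?E" by (rule single_edgesI) (use dE uniq disj in blast)+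
  qed
  have finD: "finite D" using DE E finite_vpairs finite_subset by metis
  have cardD: "card (D - J) = card D - card J"
    using insert.hyps insert.prems(1) by (intro card_Diff_subset) auto
  have "card (insert e J) \<le> card D" using insert.prems(1) finD by (intro card_mono)
  then have "f (insert {c e, h e} ?E) = f ?E"
    by (intro attach_single_edge[OF Ev D', of e])
      (use insert.hyps insert.prems cardD in auto)
  moreover have "f ?E = f E" by (rule insert.IH) (use insert.hyps insert.prems in auto)
  ultimately show ?case by simp
qed simp

lemma edge_swap_isolated:
  assumes Z: "Z \<subseteq> vpairs n" and A: "\<And>x. x \<in> A \<Longrightarrow> x < n \<and> (\<forall>e\<in>Z. x \<notin> e)"
    and x: "x \<in> A" "y \<in> A" "x \<noteq> y" and x': "x' \<in> A" "y' \<in> A" "x' \<noteq> y'"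
  shows "f (insert {x', y'} Z) = f (insert {x, y} Z)"
proof -
  \<comment> \<open>\<open>t\<close> is where \<open>y\<close> lands after the first transposition;
    it differs from \<open>y\<close> only when \<open>y = x'\<close>.\<close>
  define t where "t = transpose x x' y"
  have t: "t \<in> A" "t \<noteq> x'" using x x' by (auto simp: t_def transpose_def)
  have "f (Z \<union> {{x', t}}) = f (Z \<union> {{x, y}})"
  proof (rule swap_invariant[of x x'])
    show "Z \<union> {{x, y}} \<subseteq> vpairs n" using Z A x by (auto simp: pair_in_vpairs)
    show "{{x', t}} = (\<lambda>e. transpose x x' ` e) ` {{x, y}}" by (simp add: t_def)
  qed (use A x x' in auto)
  moreover have "f (Z \<union> {{x', y'}}) = f (Z \<union> {{x', t}})"
  proof (rule swap_invariant[of t y'])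
    show "Z \<union> {{x', t}} \<subseteq> vpairs n" using Z A t x' by (auto simp: pair_in_vpairs)
    show "{{x', y'}} = (\<lambda>e. transpose t y' ` e) ` {{x', t}}"
      using t(2) x'(3) by (simp add: transpose_apply_other insert_commute)
  qed (use A t x' in auto)
  ultimately show ?thesis by simp
qed

section \<open>Graphs with a single-edge component\<close>

text \<open>Sensitive pairs at \<open>Z\<close>, where \<open>g\<close> is deleted, bound the
  isolated vertices by the order of the square root of \<open>k\<close>; hence most edges are
  single. The spider \<open>H\<close> built from them then has too many sensitive pairs.\<close>

lemma no_critical_with_single_edge:
  assumes Gv: "G \<subseteq> vpairs n" and fG: "f G" and crit: "\<And>e. e \<in> G \<Longrightarrow> \<not> f (G - {e})"
    and g: "g \<in> single_edges G" and large: "300 \<le> k"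
  shows False
proof -
  have fin: "finite G" using Gv finite_vpairs finite_subset by blast
  have m: "card G < k"
    by (rule sensitive_card[of G]) (use Gv fG crit in auto)
  define I where "I = isolated n G"
  have I: "x < n" "\<And>e. e \<in> G \<Longrightarrow> x \<notin> e" if "x \<in> I" for x
    using that fin by (auto simp: I_def isolated_def deg_0_iff)
  have finI: "finite I" by (simp add: I_def)
  have gG: "g \<in> G" using g single_edges_subset by blast
  obtain a b where ab: "g = {a, b}" "a < n" "b < n" "a \<noteq> b" using gG Gv by (meson subsetD vpairsE)
  have abI: "a \<notin> I" "b \<notin> I" using I(2) gG ab(1) by blast+
  define Z where "Z = G - {g}"
  have Zv: "Z \<subseteq> vpairs n" using Gv by (auto simp: Z_def)
  have fZ: "\<not> f Z" using crit[OF gG] by (simp add: Z_def)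
  have gZ: "insert {a, b} Z = G" using gG ab(1) by (auto simp: Z_def)
  let ?A = "insert a (insert b I)"
  have Z_iso: "x < n \<and> (\<forall>e\<in>Z. x \<notin> e)" if "x \<in> ?A" for x
  proof -
    have "x \<notin> e" if "e \<in> Z" "x \<in> {a, b}" for e
      using that single_edges_unique[OF g, of e x] ab(1) unfolding Z_def by blast
    then show ?thesis using that I ab by (auto simp: Z_def)
  qed

  \<comment> \<open>In \<open>Z\<close> the vertices \<open>a\<close> and \<open>b\<close> are
    isolated too, and any pair inside \<open>?A\<close> restores a copy of \<open>G\<close>.\<close>
  have "card {e. e \<subseteq> ?A \<and> card e = 2} < k"
  proof (rule sensitive_card[OF Zv])
    show "{e. e \<subseteq> ?A \<and> card e = 2} \<subseteq> vpairs n"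
      using Z_iso by (fastforce simp: card_2_iff pair_in_vpairs)
  next
    fix e assume e: "e \<in> {e. e \<subseteq> ?A \<and> card e = 2}" "e \<in> Z"
    then obtain x where "x \<in> e" "x \<in> ?A" by (fastforce simp: card_2_iff)
    then show "f (Z - {e}) \<noteq> f Z" using Z_iso e(2) by blast
  next
    fix e assume "e \<in> {e. e \<subseteq> ?A \<and> card e = 2}"
    then obtain x y where xy: "e = {x, y}" "x \<noteq> y" "x \<in> ?A" "y \<in> ?A" by (auto simp: card_2_iff)
    have "f (insert {x, y} Z) = f (insert {a, b} Z)"
      by (rule edge_swap_isolated[where A = ?A]) (use Zv Z_iso xy ab in auto)
    then show "f (insert e Z) \<noteq> f Z" using fZ fG gZ xy(1) by simp
  qed
  moreover have "card ?A = card I + 2" using finI abI ab(4) by simp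
  ultimately have "(card I + 2) choose 2 < k" using finI n_subsets[of ?A 2] by simp
  then have "(card I + 2) * (card I + 1) div 2 < k" by (simp add: choose_two)
  then have "(card I + 2) * (card I + 1) < 2 * k" by linarith
  moreover have "card I * card I \<le> (card I + 2) * (card I + 1)" by (intro mult_le_mono) auto
  ultimately have isq: "card I * card I < 2 * k" by linarith
  \<comment> \<open>Otherwise the square of \<open>card I\<close> is below \<open>2 * k\<close>,
    hence below \<open>24 * card I\<close>, so \<open>card I < 24\<close>, against
    \<open>300 \<le> k\<close>.\<close>
  have small: "12 * card I \<le> k + 12"
  proof (rule ccontr)
    assume *: "\<not> ?thesis"
    then have "card I * card I < card I * 24" using isq by linarith
    then have "card I < 24" by simp
    then show False using * large by simp
  qed
  have qm: "card (single_edges G) \<le> card G"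
    using fin single_edges_subset by (rule card_mono)
  \<comment> \<open>At most \<open>k - 1\<close> edges cover at most \<open>2 * k - 2\<close>
    vertices, so at least two vertices are isolated.\<close>
  have i2: "card I \<ge> 2"
    using single_edges_bound[OF Gv] qm m two_k unfolding I_def by linarith
  define D where "D = single_edges G - {g}"
  have finD: "finite D" using fin single_edges_subset finite_subset unfolding D_def by blast
  have cardD: "card D + 1 = card (single_edges G)"
    using g fin single_edges_subset finite_subset unfolding D_def
    by (metis Suc_eq_plus1 card_Suc_Diff1)
  \<comment> \<open>\<open>t\<close> is \<open>k / 3\<close> rounded up, the number of legs. Each
    foot will be paired with the at least three vertices of \<open>insert b I\<close>, giving
    \<open>k\<close> pairs.\<close>
  define t where "t = (k + 2) div 3"
  have t3: "k \<le> 3 * t" by (simp add: t_def)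
  \<comment> \<open>As \<open>card I\<close> is at most \<open>k / 12 + 1\<close>, \<open>D\<close>
    keeps at least \<open>5 * k / 6\<close> edges, enough for \<open>t\<close> attachments.\<close>
  have tD: "k + 2 * t \<le> 2 * card D + 2"
    using single_edges_bound[OF Gv] small m two_k cardD unfolding I_def t_def by linarith
  then have "t \<le> card D" using t3 large unfolding t_def by linarith
  then obtain J where J: "J \<subseteq> D" "card J = t" "finite J"
    using obtain_subset_with_card_n by metis
  have DG: "D \<subseteq> G" using single_edges_subset unfolding D_def by blast
  have D_uniq: "e' = e" if "e \<in> D" "e' \<in> G" "x \<in> e" "x \<in> e'" for e e' x
    using single_edges_unique[of e G e' x] that unfolding D_def by blast
  have D_disj: "x \<notin> e" if "e \<in> D" "x \<in> ?A" for e x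
    using that DG Z_iso unfolding D_def Z_def by blast
  have "\<exists>x y. e = {x, y} \<and> x < n \<and> y < n \<and> x \<noteq> y" if "e \<in> D" for e
    using that DG Gv by (meson subsetD vpairsE)
  \<comment> \<open>The spider will have centre \<open>a\<close>, knees \<open>h e\<close> and feet
    \<open>r e\<close>.\<close>
  then obtain h r where hr: "\<And>e. e \<in> D \<Longrightarrow> e = {h e, r e} \<and> h e < n \<and> r e < n \<and> h e \<noteq> r e"
    by metis
  have hr_in: "h e \<in> e" "r e \<in> e" if "e \<in> D" for e using hr[OF that] by blast+
  define H where "H = Z \<union> (\<lambda>e. {a, h e}) ` J"
  have "f H = f Z" unfolding H_def
  proof (rule attach_single_edges[OF Zv, of D])
    show "D \<subseteq> single_edges Z"
    proof
      fix d assume d: "d \<in> D"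
      show "d \<in> single_edges Z"
        by (rule single_edgesI) (use d DG D_uniq[OF d] in \<open>auto simp: Z_def D_def\<close>)
    qed
    show "h e \<in> e" if "e \<in> J" for e using that J hr_in by blast
    show "a < n \<and> a \<notin> \<Union>D" if "e \<in> J" for e using ab D_disj by blast
  qed (use J tD in auto)
  then have fH: "\<not> f H" using fZ by simp
  have ahe: "a \<noteq> h e" if "e \<in> D" for e using D_disj[OF that, of a] hr_in[OF that] by auto
  have Hv: "H \<subseteq> vpairs n"
    using Zv J(1) ab hr ahe by (fastforce simp: H_def pair_in_vpairs)

  \<comment> \<open>The new graph contains the matching \<open>{a, h e}, {r e, z}\<close> instead of \<open>g, e\<close>.\<close>
  have one: "f (insert {r e, z} H)" if e: "e \<in> J" and z: "z \<in> insert b I" for e z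
  proof -
    have eD: "e \<in> D" using e J by blast
    let ?h = "h e" and ?r = "r e"
    have e_eq: "e = {?h, ?r}" and hrn: "?h < n" "?r < n" "?h \<noteq> ?r" using hr[OF eD] by auto
    have zn: "z < n" using z I(1) ab by auto
    have ne: "a \<noteq> ?h" "a \<noteq> ?r" "b \<noteq> ?h" "b \<noteq> ?r" "z \<noteq> ?h" "z \<noteq> ?r" "a \<noteq> z"
      using D_disj[OF eD] hr_in[OF eD] z abI ab by auto
    define R where "R = G - {g, e}"
    have R_iso: "x \<notin> d" if "d \<in> R" "x \<in> insert ?h (insert ?r ?A)" for d x
      using that Z_iso D_uniq[OF eD] hr_in[OF eD] by (auto simp: R_def Z_def)
    \<comment> \<open>\<open>Y\<close> is a copy of \<open>G\<close>: exchange \<open>b\<close> with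
      \<open>?h\<close>, then \<open>b\<close> with \<open>z\<close>.\<close>
    define Y where "Y = R \<union> {{a, ?h}, {z, ?r}}"
    have Yv: "Y \<subseteq> vpairs n" using Gv ab hrn zn ne by (auto simp: Y_def R_def pair_in_vpairs)
    have "f (R \<union> {{a, ?h}, {b, ?r}}) = f (R \<union> {{a, b}, {?h, ?r}})"
    proof (rule swap_invariant[of b ?h])
      show "R \<union> {{a, b}, {?h, ?r}} \<subseteq> vpairs n" using Gv ab hrn by (auto simp: R_def pair_in_vpairs)
      show "b \<notin> d \<and> ?h \<notin> d" if "d \<in> R" for d using R_iso[OF that] by blast
      show "{{a, ?h}, {b, ?r}} = (\<lambda>e. transpose b ?h ` e) ` {{a, b}, {?h, ?r}}"
        using ne ab(4) hrn(3) by (simp add: transpose_apply_other insert_commute)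
    qed (use ab hrn in auto)
    moreover have "f Y = f (R \<union> {{a, ?h}, {b, ?r}})" unfolding Y_def
    proof (rule swap_invariant[of b z])
      show "R \<union> {{a, ?h}, {b, ?r}} \<subseteq> vpairs n"
        using Gv ab hrn ne by (auto simp: R_def pair_in_vpairs)
      show "b \<notin> d \<and> z \<notin> d" if "d \<in> R" for d using R_iso[OF that] z by blast
      show "{{a, ?h}, {z, ?r}} = (\<lambda>e. transpose b z ` e) ` {{a, ?h}, {b, ?r}}"
        using ne ab(4) hrn(3) by (simp add: transpose_apply_other insert_commute)
    qed (use ab zn in auto)
    moreover have "R \<union> {{a, b}, {?h, ?r}} = G"
      unfolding R_def e_eq[symmetric] ab(1)[symmetric] using gG eD DG by blast
    ultimately have fY: "f Y" using fG by simp
    let ?z = "{z, ?r}"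
    have zD: "?z \<notin> D" using D_disj[of ?z z] z by blast
    \<comment> \<open>In \<open>Y\<close> the single edge \<open>?z\<close> plays the part of
      \<open>e\<close>. Hanging its end \<open>?r\<close> on \<open>?h\<close> restores the edge
      \<open>e\<close>, while the other edges of \<open>J\<close> are hung on \<open>a\<close> as in
      \<open>H\<close>; the result is \<open>insert {r e, z} H\<close>.\<close>
    define c' where "c' d = (if d = ?z then ?h else a)" for d
    define h' where "h' d = (if d = ?z then ?r else h d)" for d
    let ?D = "insert ?z (D - {e})" and ?J = "insert ?z (J - {e})"
    have "f (Y \<union> (\<lambda>d. {c' d, h' d}) ` ?J) = f Y"
    proof (rule attach_single_edges[OF Yv, of ?D])
      show "?D \<subseteq> single_edges Y"
      proof
        fix d assume "d \<in> ?D"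
        then consider "d = ?z" | "d \<in> D" "d \<noteq> e" by blast
        then show "d \<in> single_edges Y"
        proof cases
          case 1
          have "d' \<inter> ?z = {}" if "d' \<in> R" for d' using R_iso[OF that] z by blast
          moreover have "{a, ?h} \<inter> ?z = {}" using ne hrn(3) by auto
          ultimately show ?thesis unfolding 1 Y_def by (intro single_edgesI) blast+
        next
          case 2
          have "d \<in> R" using 2 DG unfolding R_def D_def by blast
          moreover have "d' = d" if "d' \<in> R" "d' \<inter> d \<noteq> {}" for d'
            using D_uniq[OF 2(1)] that unfolding R_def by blast
          moreover have "{a, ?h} \<inter> d = {}" "?z \<inter> d = {}"
            using R_iso[OF \<open>d \<in> R\<close>] z by blast+
          ultimately show ?thesis unfolding Y_def by (intro single_edgesI) blast+
        qed
      qed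
      show "finite ?J" "?J \<subseteq> ?D" using J by auto
      show "h' d \<in> d" if "d \<in> ?J" for d using that J(1) hr_in by (auto simp: h'_def)
      show "c' d < n \<and> c' d \<notin> \<Union>?D" if "d \<in> ?J" for d
      proof -
        have "a \<notin> \<Union>?D" using D_disj ne by auto
        moreover have "?h \<notin> \<Union>?D"
        proof
          assume "?h \<in> \<Union>?D"
          then obtain d where "d \<in> D" "d \<noteq> e" "?h \<in> d" using ne hrn(3) by auto
          then show False using D_uniq[of d e ?h] hr_in[OF eD] eD DG by blast
        qed
        ultimately show ?thesis using ab hrn by (auto simp: c'_def)
      qed
      have "card ?D = card D" using zD finD card_Suc_Diff1[OF finD eD] by simp
      moreover have "card ?J = card J" using zD J card_Suc_Diff1[OF J(3) e] by (auto simp: card_insert_if)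
      ultimately show "k + 2 * card ?J \<le> 2 * card ?D + 2" using tD J(2) by simp
    qed
    moreover have "(\<lambda>d. {c' d, h' d}) ` ?J = insert e ((\<lambda>d. {a, h d}) ` (J - {e}))"
    proof -
      have "(\<lambda>d. {c' d, h' d}) ` (J - {e}) = (\<lambda>d. {a, h d}) ` (J - {e})"
        using zD J(1) by (intro image_cong) (auto simp: c'_def h'_def)
      then show ?thesis using e_eq by (simp add: c'_def h'_def)
    qed
    moreover have "Y \<union> insert e ((\<lambda>d. {a, h d}) ` (J - {e})) = insert {?r, z} H"
    proof -
      have "insert e R = Z" using eD DG unfolding R_def Z_def D_def by blast
      moreover have "(\<lambda>d. {a, h d}) ` J = insert {a, ?h} ((\<lambda>d. {a, h d}) ` (J - {e}))"
        using e by blast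
      ultimately show ?thesis unfolding Y_def H_def by (auto simp: insert_commute)
    qed
    ultimately show ?thesis using fY by metis
  qed

  let ?p = "\<lambda>(e, z). {r e, z}"
  have "card (?p ` (J \<times> insert b I)) < k"
  proof (rule sensitive_card[OF Hv])
    show "?p ` (J \<times> insert b I) \<subseteq> vpairs n"
    proof
      fix d assume "d \<in> ?p ` (J \<times> insert b I)"
      then obtain e z where ez: "d = {r e, z}" "e \<in> D" "z \<in> ?A" using J by auto
      then have "z \<noteq> r e" using D_disj hr_in by metis
      then show "d \<in> vpairs n" using ez hr[OF ez(2)] Z_iso[OF ez(3)] by (auto simp: pair_in_vpairs)
    qed
  next
    fix d assume d: "d \<in> ?p ` (J \<times> insert b I)" "d \<in> H"
    then obtain e z where ez: "d = {r e, z}" "e \<in> D" "z \<in> insert b I" using J by auto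
    have "z \<notin> d'" if "d' \<in> H" for d'
    proof -
      have "z \<noteq> h e'" if "e' \<in> D" for e' using D_disj[OF that, of z] hr_in[OF that] ez(3) by auto
      moreover have "z \<noteq> a" using ez(3) ab abI by auto
      ultimately show ?thesis using that Z_iso[of z] ez(3) J(1) by (auto simp: H_def)
    qed
    then show "f (H - {d}) \<noteq> f H" using d(2) ez(1) by blast
  next
    fix d assume "d \<in> ?p ` (J \<times> insert b I)"
    then show "f (insert d H) \<noteq> f H" using one fH by auto
  qed
  moreover have "inj_on ?p (J \<times> insert b I)"
  proof (rule inj_onI)
    fix s s' assume s: "s \<in> J \<times> insert b I" "s' \<in> J \<times> insert b I" "?p s = ?p s'"
    obtain e z e' z' where ez: "s = (e, z)" "s' = (e', z')" by (metis surj_pair)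
    have mem: "e \<in> D" "e' \<in> D" "z \<in> ?A" "z' \<in> ?A" using s ez J(1) by auto
    have "r e \<noteq> z'" using D_disj[OF mem(1,4)] hr_in[OF mem(1)] by auto
    then have rz: "r e = r e'" "z = z'" using s(3) ez by (auto simp: doubleton_eq_iff)
    have "e' = e" using D_uniq[OF mem(1), of e' "r e"] hr_in mem DG rz(1) by (metis subsetD)
    then show "s = s'" using ez rz by simp
  qed
  ultimately have "card (J \<times> insert b I) < k" by (simp add: card_image)
  moreover have "card (J \<times> insert b I) = t * (card I + 1)"
    using J finI abI by (simp add: card_cartesian_product)
  moreover have "t * 3 \<le> t * (card I + 1)" using i2 by (intro mult_le_mono) auto
  ultimately show False using t3 by linarith
qed

section \<open>Graphs with a leaf and no single-edge component\<close>

text \<open>Ordered pairs of support vertices are covered by the diagonal, the relation given by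
  \<open>B\<close>, and \<open>A\<close> with its converse. Deleting a leaf edge bounds each
  \<open>B v\<close>, the sensitivity at \<open>G\<close> bounds \<open>A\<close>, and there are too
  many support vertices for this cover.\<close>

lemma no_critical_with_leaf_without_single_edge:
  assumes Gv: "G \<subseteq> vpairs n" and fG: "f G" and crit: "\<And>e. e \<in> G \<Longrightarrow> \<not> f (G - {e})"
    and no_single: "single_edges G = {}" and leaf: "deg G u = 1"
  shows False
proof -
  have fin: "finite G" using Gv finite_vpairs finite_subset by blast
  define I where "I = isolated n G"
  have I: "x < n" "\<And>e. e \<in> G \<Longrightarrow> x \<notin> e" if "x \<in> I" for x
    using that fin by (auto simp: I_def isolated_def deg_0_iff)
  have finI: "finite I" by (simp add: I_def)
  define W where "W = supports n G"
  have finW: "finite W" by (simp add: W_def)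
  have "\<forall>v\<in>W. \<exists>l. {l, v} \<in> G \<and> deg G l = 1" by (auto simp: W_def supports_def)
  then obtain l where l: "\<And>v. v \<in> W \<Longrightarrow> {l v, v} \<in> G" "\<And>v. v \<in> W \<Longrightarrow> deg G (l v) = 1"
    by metis
  have l_edge: "e = {l v, v}" if "v \<in> W" "e \<in> G" "l v \<in> e" for v e
    using deg_1_unique[OF l(2)[OF that(1)] that(2,3) l(1)[OF that(1)]] by simp
  have lv: "l v < n" "v < n" "l v \<noteq> v" if "v \<in> W" for v
    using l(1)[OF that] Gv pair_in_vpairs by blast+
  have W_ne_l: "v \<noteq> l v'" if "v \<in> W" "v' \<in> W" for v v'
  proof
    assume "v = l v'"
    then have "{l v, v} \<in> single_edges G"
      using l(1)[OF that(1)] l(2)[OF that(1)] l(2)[OF that(2)] by (simp add: single_edges_def)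
    then show False using no_single by simp
  qed
  have l_inj: "v = v'" if "v \<in> W" "v' \<in> W" "l v = l v'" for v v'
    using l_edge[OF that(1) l(1)[OF that(2)]] that(3) lv(3)[OF that(1)]
    by (auto simp: doubleton_eq_iff)
  have WI: "v \<notin> I" "l v \<notin> I" if "v \<in> W" for v
    using I(2) l(1)[OF that] by blast+
  have W_ne: "W \<noteq> {}"
  proof -
    have "\<exists>e\<in>G. u \<in> e" using leaf fin deg_pos_iff[of G u] by simp
    then obtain e where e: "e \<in> G" "u \<in> e" by blast
    then obtain v where "e = {u, v}" "v < n" using Gv by (meson subsetD vpairs_memE)
    then have "v \<in> W" using e leaf by (auto simp: W_def supports_def)
    then show ?thesis by blast
  qed
  have m: "card G < k"
    by (rule sensitive_card[of G]) (use Gv fG crit in auto)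
  \<comment> \<open>Needed for the two stars of \<open>card I + 1\<close> pairs each at the graph
    \<open>H\<close> below.\<close>
  have i2: "k \<le> 2 * (card I + 1)"
    using single_edges_bound[OF Gv] no_single m two_k by (simp add: I_def)
  have w: "n \<le> card G + card I + card W"
    using supports_bound[OF Gv no_single] by (simp add: I_def W_def)

  \<comment> \<open>\<open>B v\<close> holds the support vertices whose chosen leaf can replace
    \<open>l v\<close> as the far end of the leaf edge at \<open>v\<close> with \<open>f\<close>
    still true.\<close>
  define B where "B v = {v' \<in> W - {v}. f (insert {v, l v'} (G - {{l v, v}}))}" for v
  \<comment> \<open>Joining \<open>v\<close> in \<open>Z\<close> to \<open>l v\<close> or to an
    isolated vertex gives a copy of \<open>G\<close>; joining it to the chosen leaf of a vertex in
    \<open>B v\<close> makes \<open>f\<close> true by definition. All these pairs are sensitive at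
    \<open>Z\<close>.\<close>
  have B: "card I + 1 + card (B v) < k" if v: "v \<in> W" for v
  proof -
    define Z where "Z = G - {{l v, v}}"
    have fZ: "\<not> f Z" unfolding Z_def by (rule crit[OF l(1)[OF v]])
    have Z_iso: "w \<notin> e" if "e \<in> Z" "w \<in> insert (l v) I" for e w
      using that I(2) l_edge[OF v] by (auto simp: Z_def)
    have one: "f (insert {v, w} Z)" if w': "w \<in> insert (l v) I" for w
    proof -
      have wv: "w \<noteq> v" using w' lv(3)[OF v] WI(1)[OF v] by auto
      have "f (Z \<union> {{v, w}}) = f (Z \<union> {{v, l v}})"
      proof (rule swap_invariant[of w "l v"])
        show "w < n" "l v < n" using w' I(1) lv[OF v] by auto
        show "Z \<union> {{v, l v}} \<subseteq> vpairs n" using Gv lv[OF v] by (auto simp: Z_def pair_in_vpairs)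
        show "w \<notin> e \<and> l v \<notin> e" if "e \<in> Z" for e using Z_iso that w' by blast
        show "{{v, w}} = (\<lambda>e. transpose w (l v) ` e) ` {{v, l v}}"
          using wv lv(3)[OF v] by (simp add: transpose_apply_other insert_commute)
      qed
      moreover have "Z \<union> {{v, l v}} = G" using l(1)[OF v] by (auto simp: Z_def insert_commute)
      ultimately show ?thesis using fG by simp
    qed
    let ?S = "insert (l v) I \<union> l ` B v"
    have "card ((\<lambda>w. {v, w}) ` ?S) < k"
    proof (rule sensitive_card[of Z])
      show "Z \<subseteq> vpairs n" using Gv by (auto simp: Z_def)
      show "(\<lambda>w. {v, w}) ` ?S \<subseteq> vpairs n"
        using lv v I(1) WI W_ne_l by (fastforce simp: pair_in_vpairs B_def)
    next
      fix e assume e: "e \<in> (\<lambda>w. {v, w}) ` ?S" "e \<in> Z"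
      then obtain x where x: "x \<in> ?S" "e = {v, x}" by blast
      have "x \<notin> insert (l v) I" using Z_iso[OF e(2)] x(2) by auto
      then obtain v' where v': "v' \<in> W" "v' \<noteq> v" "x = l v'" using x(1) by (auto simp: B_def)
      then have "e = {l v', v'}" using l_edge[OF v'(1), of e] e(2) x(2) by (auto simp: Z_def)
      then have "v = v' \<or> v = l v'" using x(2) by auto
      then show "f (Z - {e}) \<noteq> f Z" using v' W_ne_l[OF v v'(1)] by blast
    next
      fix e assume "e \<in> (\<lambda>w. {v, w}) ` ?S"
      then show "f (insert e Z) \<noteq> f Z" using one fZ by (auto simp: B_def Z_def)
    qed
    moreover have "inj_on (\<lambda>w. {v, w}) ?S" by (auto simp: inj_on_def doubleton_eq_iff)
    moreover have "card ?S = card I + 1 + card (B v)"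
    proof -
      have "inj_on l (B v)" using l_inj by (auto simp: inj_on_def B_def)
      moreover have "insert (l v) I \<inter> l ` B v = {}" using WI l_inj v by (auto simp: B_def)
      moreover have "finite (B v)" using finW by (simp add: B_def)
      ultimately show ?thesis using finI WI(2)[OF v] by (simp add: card_Un_disjoint card_image)
    qed
    ultimately show ?thesis by (metis card_image)
  qed

  \<comment> \<open>\<open>A\<close> records pairs sensitive at \<open>G\<close> itself, so it
    shares the budget \<open>k\<close> with the edges of \<open>G\<close>.\<close>
  define A where "A = {(v, v'). v \<in> W \<and> v' \<in> W \<and> v \<noteq> v' \<and> \<not> f (insert {v, l v'} G)}"
  have finA: "finite A" by (rule finite_subset[of _ "W \<times> W"]) (auto simp: A_def finW)
  have l_nonedge: "{v, l v'} \<notin> G" if "v \<in> W" "v' \<in> W" "v \<noteq> v'" for v v'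
    using l_edge[OF that(2), of "{v, l v'}"] that W_ne_l[OF that(1,2)] by (auto simp: doubleton_eq_iff)
  have A: "card G + card A < k"
  proof -
    let ?p = "\<lambda>(v, v'). {v, l v'}"
    have "card (G \<union> ?p ` A) < k"
    proof (rule sensitive_card[of G])
      show "G \<union> ?p ` A \<subseteq> vpairs n"
        using Gv lv W_ne_l by (auto simp: A_def pair_in_vpairs)
    next
      fix e assume "e \<in> G \<union> ?p ` A" "e \<in> G"
      then show "f (G - {e}) \<noteq> f G" using crit fG by auto
    next
      fix e assume "e \<in> G \<union> ?p ` A" "e \<notin> G"
      then show "f (insert e G) \<noteq> f G" using fG by (auto simp: A_def)
    qed (rule Gv)
    moreover have "inj_on ?p A"
    proof (rule inj_onI)
      fix s t assume st: "s \<in> A" "t \<in> A" "?p s = ?p t"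
      obtain v v' y y' where vy: "s = (v, v')" "t = (y, y')" by (metis surj_pair)
      have "v \<in> W" "v' \<in> W" "y \<in> W" "y' \<in> W" using st vy by (auto simp: A_def)
      then have "v = y \<and> l v' = l y'" using st(3) W_ne_l vy by (auto simp: doubleton_eq_iff)
      then show "s = t" using vy l_inj \<open>v' \<in> W\<close> \<open>y' \<in> W\<close> by blast
    qed
    moreover have "G \<inter> ?p ` A = {}" using l_nonedge by (auto simp: A_def)
    ultimately show ?thesis using fin finA by (simp add: card_Un_disjoint card_image)
  qed

  \<comment> \<open>Identify the leaves at \<open>v\<close> and \<open>v'\<close>; hanging any isolated vertex on \<open>v\<close> or on \<open>v'\<close> then gives
    a copy of \<open>insert {v, l v'} G\<close> or of \<open>insert {v', l v} G\<close>.\<close>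
  have pair: "(v, v') \<in> A \<or> (v', v) \<in> A"
    if v: "v \<in> W" and v': "v' \<in> W" and ne: "v \<noteq> v'" and good: "v' \<notin> B v" for v v'
  proof (rule ccontr)
    assume "\<not> ?thesis"
    then have f1: "f (insert {v, l v'} G)" and f2: "f (insert {v', l v} G)"
      using v v' ne by (auto simp: A_def)
    have lne: "l v \<noteq> l v'" using l_inj[OF v v'] ne by blast
    have nes: "v \<noteq> l v'" "v' \<noteq> l v" "v \<noteq> l v" "v' \<noteq> l v'"
      using W_ne_l v v' by blast+
    \<comment> \<open>In \<open>H\<close> the leaf \<open>l v'\<close> hangs on both
      \<open>v\<close> and \<open>v'\<close>, and \<open>l v\<close> has become isolated.\<close>
    define H where "H = insert {v, l v'} (G - {{l v, v}})"
    have fH: "\<not> f H" using good v' ne by (auto simp: B_def H_def)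
    have Hv: "H \<subseteq> vpairs n" using Gv lv v v' nes by (auto simp: H_def pair_in_vpairs)
    let ?J = "insert (l v) I"
    have H_iso: "w \<notin> e" if "e \<in> H" "w \<in> ?J" for e w
      using that I(2) l_edge[OF v] lne nes WI[OF v] WI[OF v'] by (auto simp: H_def)
    have swap: "f (insert {y, w} H) = f (insert {y, l v} H)"
      if w': "w \<in> ?J" and y: "y = v \<or> y = v'" for w y
    proof -
      have "y \<in> W" using y v v' by blast
      then have ne': "y \<noteq> w" "y \<noteq> l v" "y < n"
        using w' W_ne_l[OF _ v] WI[of y] lv[of y] by auto
      have "f (H \<union> {{y, w}}) = f (H \<union> {{y, l v}})"
      proof (rule swap_invariant[of w "l v"])
        show "w < n" "l v < n" using w' I(1) lv[OF v] by auto
        show "H \<union> {{y, l v}} \<subseteq> vpairs n" using Hv lv[OF v] ne' by (auto simp: pair_in_vpairs)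
        show "w \<notin> e \<and> l v \<notin> e" if "e \<in> H" for e using H_iso that w' by blast
        show "{{y, w}} = (\<lambda>e. transpose w (l v) ` e) ` {{y, l v}}"
          using ne' by (simp add: transpose_apply_other insert_commute)
      qed
      then show ?thesis by simp
    qed
    have "insert {v, l v} H = insert {v, l v'} G"
      using l(1)[OF v] by (auto simp: H_def insert_commute)
    then have one: "f (insert {v, w} H)" if "w \<in> ?J" for w
      using swap[OF that, of v] f1 by simp
    have "f (insert {v', l v} H)"
    proof -
      \<comment> \<open>Exchanging \<open>l v\<close> and \<open>l v'\<close> turns
        \<open>insert {v', l v} H\<close> into \<open>insert {v', l v} G\<close>.\<close>
      define R where "R = G - {{l v, v}, {l v', v'}}"
      let ?F = "{{v, l v'}, {v', l v'}, {v', l v}}" and ?F' = "{{v, l v}, {v', l v}, {v', l v'}}"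
      have "f (R \<union> ?F') = f (R \<union> ?F)"
      proof (rule swap_invariant[of "l v" "l v'"])
        show "l v < n" "l v' < n" using lv v v' by auto
        show "R \<union> ?F \<subseteq> vpairs n" using Gv lv v v' nes by (auto simp: R_def pair_in_vpairs)
        show "l v \<notin> e \<and> l v' \<notin> e" if "e \<in> R" for e
          using that l_edge[OF v] l_edge[OF v'] by (auto simp: R_def)
        show "?F' = (\<lambda>e. transpose (l v) (l v') ` e) ` ?F"
          using nes by (simp add: transpose_apply_other insert_commute)
      qed
      moreover have "R \<union> ?F' = insert {v', l v} G"
        using l(1)[OF v] l(1)[OF v'] by (auto simp: R_def insert_commute)
      moreover have "R \<union> ?F = insert {v', l v} H"
      proof -
        have "{l v', v'} \<noteq> {l v, v}" using ne lne nes by (auto simp: doubleton_eq_iff)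
        then show ?thesis using l(1)[OF v'] by (auto simp: R_def H_def insert_commute)
      qed
      ultimately show ?thesis using f2 by simp
    qed
    then have two: "f (insert {v', w} H)" if "w \<in> ?J" for w
      using swap[OF that, of v'] by simp
    let ?S = "(\<lambda>w. {v, w}) ` ?J" and ?S' = "(\<lambda>w. {v', w}) ` ?J"
    have "card (?S \<union> ?S') < k"
    proof (rule sensitive_card[OF Hv])
      show "?S \<union> ?S' \<subseteq> vpairs n"
        using lv v v' I(1) WI nes by (fastforce simp: pair_in_vpairs)
    next
      fix e assume "e \<in> ?S \<union> ?S'" "e \<in> H"
      then show "f (H - {e}) \<noteq> f H" using H_iso by auto
    next
      fix e assume "e \<in> ?S \<union> ?S'"
      then show "f (insert e H) \<noteq> f H" using one two fH by auto
    qed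
    moreover have "?S \<inter> ?S' = {}"
      using ne nes WI[OF v] WI[OF v'] by (auto simp: doubleton_eq_iff)
    moreover have "inj_on (\<lambda>w. {y, w}) ?J" for y by (auto simp: inj_on_def doubleton_eq_iff)
    moreover have "card ?J = card I + 1" using finI WI(2)[OF v] by simp
    ultimately show False
      using i2 finI card_Un_disjoint[of ?S ?S'] card_image[of "\<lambda>w. {v, w}" ?J]
        card_image[of "\<lambda>w. {v', w}" ?J] by (simp del: image_insert)
  qed

  have "W \<times> W \<subseteq> Id_on W \<union> Sigma W B \<union> (A \<union> A\<inverse>)"
    using pair by auto
  moreover have finB: "finite (B v)" for v using finW by (simp add: B_def)
  ultimately have "card (W \<times> W) \<le> card (Id_on W \<union> Sigma W B \<union> (A \<union> A\<inverse>))"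
    using finW finA by (intro card_mono) (auto simp: Id_on_def)
  also have "\<dots> \<le> card (Id_on W) + card (Sigma W B) + (card A + card (A\<inverse>))"
    by (intro order_trans[OF card_Un_le] add_mono card_Un_le)
  also have "card (Id_on W) = card W"
  proof -
    have "Id_on W = (\<lambda>v. (v, v)) ` W" by (auto simp: Id_on_def)
    then show ?thesis by (simp add: card_image inj_on_def)
  qed
  also have "card (A\<inverse>) = card A" by simp
  also have "card (Sigma W B) \<le> card W * (k - 2 - card I)"
  proof -
    have "card (B v) \<le> k - 2 - card I" if "v \<in> W" for v using B[OF that] by simp
    then have "(\<Sum>v\<in>W. card (B v)) \<le> (\<Sum>v\<in>W. k - 2 - card I)" by (rule sum_mono)
    then show ?thesis using finW finB by simp
  qed
  finally have count: "card W * card W \<le> card W + card W * (k - 2 - card I) + 2 * card A"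
    by (simp add: card_cartesian_product)
  obtain v where "v \<in> W" using W_ne by blast
  \<comment> \<open>Rules out truncation in \<open>k - 2 - card I\<close>.\<close>
  then have ik: "card I + 2 \<le> k" using B[of v] by simp
  define b where "b = k - 2 - card I"
  \<comment> \<open>From \<open>2 * k \<le> n\<close> and \<open>card G + card A < k\<close>. Now
    \<open>count\<close> fails, because \<open>card W * (card A + 2)\<close> exceeds
    \<open>2 * card A\<close>.\<close>
  have wb: "card W \<ge> b + card A + 3" using w A ik two_k unfolding b_def by linarith
  have "card W * card W \<ge> card W * (b + card A + 3)" using wb by (rule mult_le_mono2)
  moreover have "2 * card A + 3 \<le> card W * (card A + 2)"
  proof -
    have "3 * (card A + 2) \<le> card W * (card A + 2)" using wb by (intro mult_le_mono1) simp
    then show ?thesis by simp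
  qed
  moreover have "card W * (b + card A + 3) = card W + card W * b + card W * (card A + 2)"
    by (simp add: algebra_simps)
  ultimately show False using count unfolding b_def by linarith
qed

section \<open>Choice of the minimal graph and conclusion\<close>

text \<open>Takes a vertex of least positive degree among all minimal graphs. One exists because
  \<open>f {}\<close> is false, so that minimal graphs have edges.\<close>

lemma trivial_property:
  assumes large: "300 \<le> k" and f0: "\<not> f {}" and E: "E \<subseteq> vpairs n"
  shows "\<not> f E"
proof
  assume "f E"
  then obtain G0 where G0: "minimal G0" using minimal_subgraph[OF E] by blast
  define Q where "Q d \<longleftrightarrow> (\<exists>G u. minimal G \<and> u < n \<and> deg G u = d \<and> d > 0)" for d
  have "\<exists>d. Q d"
  proof -
    have "G0 \<noteq> {}" using G0 f0 by (auto simp: minimal_def)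
    then obtain e where e: "e \<in> G0" by blast
    have G0v: "G0 \<subseteq> vpairs n" using G0 by (simp add: minimal_def)
    then obtain x y where xy: "e = {x, y}" "x < n" using e by (meson subsetD vpairsE)
    have "finite G0" using G0v finite_vpairs finite_subset by blast
    then have "deg G0 x > 0" using e xy by (auto simp: deg_pos_iff)
    then show ?thesis using G0 xy(2) unfolding Q_def by blast
  qed
  define d where "d = (LEAST d. Q d)"
  have "Q d" unfolding d_def using \<open>\<exists>d. Q d\<close> by (rule LeastI_ex)
  then obtain G u where G: "minimal G" and u: "u < n" "deg G u = d" and d: "d > 0"
    unfolding Q_def by blast
  have least: "d \<le> deg C x" if "minimal C" "x < n" "deg C x > 0" for C x
    unfolding d_def by (rule Least_le) (use that in \<open>auto simp: Q_def\<close>)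
  have Gv: "G \<subseteq> vpairs n" and fG: "f G" and crit: "\<And>e. e \<in> G \<Longrightarrow> \<not> f (G - {e})"
    using G by (auto simp: minimal_def)
  show False
  proof (cases "d \<ge> 2")
    case True
    then show False using no_minimal_min_degree_ge_2[OF G u] least by blast
  next
    case False
    then have leaf: "deg G u = 1" using d u by simp
    show False
    proof (cases "single_edges G = {}")
      case True
      then show False
        using no_critical_with_leaf_without_single_edge[OF Gv fG crit _ leaf] by blast
    next
      case False
      then show False using no_critical_with_single_edge[OF Gv fG crit _ large] by blast
    qed
  qed
qed

end

theorem theorem1p2:
  shows "\<exists>N::nat. \<forall>n\<ge>N. \<forall>f :: graph_fun.
           is_graph_property n f \<and> nontrivial n f \<longrightarrow> sensitivity n f \<ge> n div 2"
proof (intro exI[of _ 600] allI impI)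
  fix n :: nat and f :: graph_fun
  \<comment> \<open>The threshold gives \<open>300 \<le> n div 2\<close>, as the case of a
    single-edge component requires.\<close>
  assume n: "600 \<le> n" and f: "is_graph_property n f \<and> nontrivial n f"
  show "sensitivity n f \<ge> n div 2"
  proof (rule ccontr)
    assume "\<not> ?thesis"
    then have less: "sensitivity n f < n div 2" by simp
    \<comment> \<open>Comparing with the value on the empty graph makes the function false there and
      preserves invariance and every sensitivity.\<close>
    define g where "g E = (f E \<noteq> f {})" for E
    have low: "sens_at n g E < n div 2" if "E \<subseteq> vpairs n" for E
    proof -
      have "sens_at n f E \<le> sensitivity n f"
        unfolding sensitivity_def using that finite_vpairs by (intro Max_ge) auto
      moreover have "sens_at n g E = sens_at n f E"
        unfolding sens_at_def g_def by (rule arg_cong[where f = card]) auto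
      ultimately show ?thesis using less by simp
    qed
    interpret low_sensitivity n "n div 2" g
    proof
      show "is_graph_property n g" using f unfolding is_graph_property_def g_def by simp
    qed (use low in auto)
    have "\<not> g E" if "E \<subseteq> vpairs n" for E
      by (rule trivial_property[OF _ _ that]) (use n in \<open>auto simp: g_def\<close>)
    then show False using f unfolding nontrivial_def g_def by metis
  qed
qed

end
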